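(* Let $R=\mathbb F_{q_1}\times\cdots\times\mathbb F_{q_t}$ be a finite product of finite fields. Let $A,B$ be nonempty proper subsets of $[t]$ and let $x\in X_A$, $y\in X_B$ be distinct vertices of $Z(R)^*$. Then (1) $x\sim y$ in $\Gamma(R)$ if and only if $A\cap B=\emptyset$; (2) $x\sim y$ in $W\Gamma(R)$ if and only if $|A^c\cup B^c|\ge 2$; (3) $x\sim y$ in $\mathcal D(R)$ if and only if $A\cap B\neq\emptyset$ and $|A^c\cup B^c|\ge 2$.
   Context: $[t]=\{1,\dots,t\}$, and $A^c=[t]\setminus A$. $Z(R)$ is the set of zero-divisors of $R$ and $Z(R)^*=Z(R)\setminus\{0\}$. For $x=(x_1,\dots,x_t)\in R$, $\operatorname{supp}(x)=\{i\in[t]: x_i\ne 0\}$. For nonempty proper $A\subsetneq[t]$, $X_A=\{x\in Z(R)^*:\operatorname{supp}(x)=A\}$. All graphs are simple. The zero-divisor graph $\Gamma(R)$ has vertex set $Z(R)^*$, with distinct $x,y$ adjacent iff $xy=0$. The weakly zero-divisor graph $W\Gamma(R)$ has vertex set $Z(R)^*$, with distinct $x,y$ adjacent iff there exist nonzero $r\in\operatorname{Ann}(x)$ and nonzero $s\in\operatorname{Ann}(y)$ with $rs=0$. One always has $E(\Gamma(R))\subseteq E(W\Gamma(R))$. The weak zero-divisor difference graph $\mathcal D(R)$ is the graph on $Z(R)^*$ with edge set $E(W\Gamma(R))\setminus E(\Gamma(R))$, with resulting isolated vertices deleted; "$x\sim y$ in $\mathcal D(R)$" means $\{x,y\}\in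 E(W\Gamma(R))\setminus E(\Gamma(R))$. *)

theory Defs
  imports "HOL-Algebra.Chinese_Remainder"
begin

text \<open>Edges are two-element sets of vertices.\<close>

record 'v simple_graph =
  verts :: "'v set"
  edges :: "'v set set"

definition adjacent :: "'v simple_graph \<Rightarrow> 'v \<Rightarrow> 'v \<Rightarrow> bool"
  where "adjacent G x y \<longleftrightarrow> {x, y} \<in> edges G"

text \<open>Since an edge is an unordered pair, this is meant for a predicate \<open>P\<close> that is symmetric
  on \<open>V\<close>; both predicates used below are symmetric when the ring is commutative.\<close>

definition graph_on :: "'v set \<Rightarrow> ('v \<Rightarrow> 'v \<Rightarrow> bool) \<Rightarrow> 'v simple_graph"
  where "graph_on V P =
    \<lparr>verts = V, edges = {{x, y} | x y. x \<in> V \<and> y \<in> V \<and> x \<noteq> y \<and> P x y}\<rparr>"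

definition delete_isolated :: "'v simple_graph \<Rightarrow> 'v simple_graph"
  where "delete_isolated G =
    \<lparr>verts = {v \<in> verts G. \<exists>e \<in> edges G. v \<in> e}, edges = edges G\<rparr>"

text \<open>In a nonzero ring, zero counts as a zero-divisor.\<close>

definition zero_divisors :: "('a, 'm) ring_scheme \<Rightarrow> 'a set"
  where "zero_divisors R =
    {x \<in> carrier R. \<exists>y \<in> carrier R. y \<noteq> \<zero>\<^bsub>R\<^esub> \<and> x \<otimes>\<^bsub>R\<^esub> y = \<zero>\<^bsub>R\<^esub>}"

definition nonzero_zero_divisors :: "('a, 'm) ring_scheme \<Rightarrow> 'a set"
  where "nonzero_zero_divisors R = zero_divisors R - {\<zero>\<^bsub>R\<^esub>}"

definition Ann :: "('a, 'm) ring_scheme \<Rightarrow> 'a \<Rightarrow> 'a set"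
  where "Ann R x = {r \<in> carrier R. r \<otimes>\<^bsub>R\<^esub> x = \<zero>\<^bsub>R\<^esub>}"

definition zero_divisor_graph :: "('a, 'm) ring_scheme \<Rightarrow> 'a simple_graph"
  where "zero_divisor_graph R =
    graph_on (nonzero_zero_divisors R) (\<lambda>x y. x \<otimes>\<^bsub>R\<^esub> y = \<zero>\<^bsub>R\<^esub>)"

definition weakly_zero_divisor_graph :: "('a, 'm) ring_scheme \<Rightarrow> 'a simple_graph"
  where "weakly_zero_divisor_graph R =
    graph_on (nonzero_zero_divisors R)
      (\<lambda>x y. \<exists>r \<in> Ann R x. \<exists>s \<in> Ann R y.
         r \<noteq> \<zero>\<^bsub>R\<^esub> \<and> s \<noteq> \<zero>\<^bsub>R\<^esub> \<and> r \<otimes>\<^bsub>R\<^esub> s = \<zero>\<^bsub>R\<^esub>)"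

definition weak_zero_divisor_difference_graph :: "('a, 'm) ring_scheme \<Rightarrow> 'a simple_graph"
  where "weak_zero_divisor_difference_graph R =
    delete_isolated
      \<lparr>verts = nonzero_zero_divisors R,
       edges = edges (weakly_zero_divisor_graph R) - edges (zero_divisor_graph R)\<rparr>"

text \<open>The product of the rings in the list \<open>Fs\<close> is \<^const>\<open>RDirProd_list\<close> \<open>Fs\<close>, whose elements are
  lists. Coordinates are numbered from 1, so the \<open>i\<close>-th coordinate of \<open>x\<close> is \<open>x ! (i - 1)\<close>.
  All factors have their carrier in one type; this is no loss of generality for
  finite rings, which can all be realised with carriers in an infinite type such as \<^typ>\<open>nat\<close>.\<close>

definition supp :: "('a, 'm) ring_scheme list \<Rightarrow> 'a list \<Rightarrow> nat set"
  where "supp Fs x = {i \<in> {1..length Fs}. x ! (i - 1) \<noteq> \<zero>\<^bsub>Fs ! (i - 1)\<^esub>}"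

definition support_class :: "('a, 'm) ring_scheme list \<Rightarrow> nat set \<Rightarrow> 'a list set"
  where "support_class Fs A = {x \<in> nonzero_zero_divisors (RDirProd_list Fs). supp Fs x = A}"

end

theory Submission
  imports Defs
begin

text \<open>Over domains, a product of two elements of the product ring vanishes iff their supports are
  disjoint, and every subset of the index set is the support of some element. A nonzero
  annihilator of \<open>x\<close> is thus an element with nonempty support inside the complement of \<open>supp x\<close>,
  so \<open>x\<close> and \<open>y\<close> are weakly adjacent iff one can choose distinct \<open>i \<in> A\<^sup>c\<close> and
  \<open>j \<in> B\<^sup>c\<close>; as both complements are nonempty, this fails only when both equal one common
  singleton.\<close>

text \<open>Consing is a ring homomorphism from the binary product
  \<open>RDirProd R (RDirProd_list Rs)\<close>, where multiplication is componentwise by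
  definition.\<close>

lemma RDirProd_list_mult_Cons:
  assumes "a \<in> carrier R" "b \<in> carrier R"
    and "as \<in> carrier (RDirProd_list Rs)" "bs \<in> carrier (RDirProd_list Rs)"
  shows "(a # as) \<otimes>\<^bsub>RDirProd_list (R # Rs)\<^esub> (b # bs)
    = (a \<otimes>\<^bsub>R\<^esub> b) # (as \<otimes>\<^bsub>RDirProd_list Rs\<^esub> bs)"
proof -
  have "(a, as) \<in> carrier (RDirProd R (RDirProd_list Rs))"
    "(b, bs) \<in> carrier (RDirProd R (RDirProd_list Rs))"
    using assms by (auto simp: RDirProd_carrier)
  from ring_hom_mult[OF RDirProd_list_hom1 this] show ?thesis
    by (simp add: RDirProd_def DirProd_def monoid.defs)
qed

text \<open>Both parts are needed to compare a product with the zero list: equality of lists is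
  equality of lengths and of all entries.\<close>

lemma RDirProd_list_mult:
  assumes "as \<in> carrier (RDirProd_list Rs)" "bs \<in> carrier (RDirProd_list Rs)"
  shows "length (as \<otimes>\<^bsub>RDirProd_list Rs\<^esub> bs) = length Rs"
    and "i < length Rs \<Longrightarrow>
      (as \<otimes>\<^bsub>RDirProd_list Rs\<^esub> bs) ! i = as ! i \<otimes>\<^bsub>Rs ! i\<^esub> bs ! i"
  using assms
proof (induction Rs arbitrary: as bs i)
  case Nil
  { case 1 then show ?case by (simp add: monoid.defs)
  next
    case 2 then show ?case by simp }
next
  case (Cons R Rs)
  { case 1 then show ?case
      using Cons.IH(1) by (auto simp: RDirProd_list_carrier RDirProd_list_mult_Cons)
  next
    case 2 then show ?case
      using Cons.IH(2)
      by (auto simp: RDirProd_list_carrier RDirProd_list_mult_Cons nth_Cons split: nat.split) }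
qed

lemma RDirProd_list_zero_eq_map: "\<zero>\<^bsub>RDirProd_list Rs\<^esub> = map (\<lambda>R. \<zero>\<^bsub>R\<^esub>) Rs"
  unfolding RDirProd_list_zero by (induction Rs) simp_all

lemma supp_subset: "supp Fs x \<subseteq> {1..length Fs}"
  by (auto simp: supp_def)

text \<open>Supports count coordinates from 1 and lists from 0; writing the index as
  \<open>Suc i\<close> removes the subtraction in \<open>supp\<close>.\<close>

lemma mem_supp_Suc: "Suc i \<in> supp Fs x \<longleftrightarrow> i < length Fs \<and> x ! i \<noteq> \<zero>\<^bsub>Fs ! i\<^esub>"
  by (auto simp: supp_def)

text \<open>Since 0 lies outside \<open>{1..n}\<close>, testing successors suffices. This lets
  emptiness of supports be checked on list positions.\<close>

lemma eq_empty_iff_Suc: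
  assumes "S \<subseteq> {1..n}"
  shows "S = {} \<longleftrightarrow> (\<forall>i. Suc i \<notin> S)"
proof
  assume S: "\<forall>i. Suc i \<notin> S"
  have "i \<notin> S" for i
    using assms S by (cases i) auto
  then show "S = {}" by blast
qed simp

lemma supp_eq_empty_iff:
  assumes "x \<in> carrier (RDirProd_list Fs)"
  shows "supp Fs x = {} \<longleftrightarrow> x = \<zero>\<^bsub>RDirProd_list Fs\<^esub>"
proof -
  have "supp Fs x = {} \<longleftrightarrow> (\<forall>i < length Fs. x ! i = \<zero>\<^bsub>Fs ! i\<^esub>)"
    by (auto simp: eq_empty_iff_Suc[OF supp_subset] mem_supp_Suc)
  then show ?thesis
    using RDirProd_list_carrier_mem(1)[OF assms]
    by (auto simp: RDirProd_list_zero_eq_map list_eq_iff_nth_eq)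
qed

lemma mult_eq_zero_iff_supp_disjoint:
  assumes dom: "\<forall>F \<in> set Fs. domain F"
    and x: "x \<in> carrier (RDirProd_list Fs)" and y: "y \<in> carrier (RDirProd_list Fs)"
  shows "x \<otimes>\<^bsub>RDirProd_list Fs\<^esub> y = \<zero>\<^bsub>RDirProd_list Fs\<^esub> \<longleftrightarrow> supp Fs x \<inter> supp Fs y = {}"
proof -
  \<comment> \<open>Integrality of each factor enters here; it turns vanishing of a coordinate of
    the product into absence of that index from one of the supports.\<close>
  have coord: "x ! i \<otimes>\<^bsub>Fs ! i\<^esub> y ! i = \<zero>\<^bsub>Fs ! i\<^esub>
      \<longleftrightarrow> x ! i = \<zero>\<^bsub>Fs ! i\<^esub> \<or> y ! i = \<zero>\<^bsub>Fs ! i\<^esub>" if "i < length Fs" for i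
    using that dom x y by (intro domain.integral_iff) (auto dest: RDirProd_list_carrier_mem(2))
  have "x \<otimes>\<^bsub>RDirProd_list Fs\<^esub> y = \<zero>\<^bsub>RDirProd_list Fs\<^esub>
      \<longleftrightarrow> (\<forall>i < length Fs. x ! i \<otimes>\<^bsub>Fs ! i\<^esub> y ! i = \<zero>\<^bsub>Fs ! i\<^esub>)"
    using RDirProd_list_mult[OF x y]
    by (simp add: RDirProd_list_zero_eq_map list_eq_iff_nth_eq)
  also have "\<dots> \<longleftrightarrow> (\<forall>i. Suc i \<notin> supp Fs x \<inter> supp Fs y)"
    using coord by (auto simp: mem_supp_Suc)
  also have "\<dots> \<longleftrightarrow> supp Fs x \<inter> supp Fs y = {}"
    by (rule eq_empty_iff_Suc[symmetric, of _ "length Fs"]) (use supp_subset in blast)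
  finally show ?thesis .
qed

lemma exists_supp_eq:
  assumes dom: "\<forall>F \<in> set Fs. domain F" and S: "S \<subseteq> {1..length Fs}"
  obtains r where "r \<in> carrier (RDirProd_list Fs)" "supp Fs r = S"
proof
  \<comment> \<open>The witness is the characteristic vector of \<open>S\<close>. Its support is all
    of \<open>S\<close> because one differs from zero in every factor.\<close>
  define r where
    "r = map (\<lambda>i. if Suc i \<in> S then \<one>\<^bsub>Fs ! i\<^esub> else \<zero>\<^bsub>Fs ! i\<^esub>) [0..<length Fs]"
  have F: "domain (Fs ! i)" if "i < length Fs" for i
    using dom that by simp
  have R: "ring (Fs ! i)" if "i < length Fs" for i
    using F[OF that] by (simp add: domain_def cring_def)
  show "r \<in> carrier (RDirProd_list Fs)"
    by (rule RDirProd_list_carrier_memI)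
      (auto simp: r_def intro: ring.ring_simprules R)
  have "i \<in> supp Fs r \<longleftrightarrow> i \<in> S" if "i \<in> {1..length Fs}" for i
  proof -
    from that obtain k where k: "i = Suc k" "k < length Fs"
      by (cases i) auto
    then show ?thesis
      using domain.one_not_zero[OF F[OF k(2)]] by (simp add: mem_supp_Suc r_def)
  qed
  then show "supp Fs r = S"
    using S supp_subset[of Fs r] by blast
qed

lemma exists_distinct_mem_iff_two_le_card_Un:
  assumes "finite A" "finite B" "A \<noteq> {}" "B \<noteq> {}"
  shows "(\<exists>i \<in> A. \<exists>j \<in> B. i \<noteq> j) \<longleftrightarrow> 2 \<le> card (A \<union> B)"
proof
  assume "\<exists>i \<in> A. \<exists>j \<in> B. i \<noteq> j"
  then obtain i j where ij: "i \<in> A" "j \<in> B" "i \<noteq> j" by blast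
  then have "card {i, j} \<le> card (A \<union> B)"
    using assms by (intro card_mono) auto
  then show "2 \<le> card (A \<union> B)" using ij by simp
next
  assume card: "2 \<le> card (A \<union> B)"
  show "\<exists>i \<in> A. \<exists>j \<in> B. i \<noteq> j"
  proof (rule ccontr)
    assume "\<not> ?thesis"
    then have eq: "i = j" if "i \<in> A" "j \<in> B" for i j using that by blast
    obtain k where "k \<in> A" using assms(3) by blast
    \<comment> \<open>Every element of \<open>B\<close> equals \<open>k\<close>; every element of
      \<open>A\<close> equals some element of the nonempty set \<open>B\<close>, hence
      \<open>k\<close> as well.\<close>
    have "A \<union> B \<subseteq> {k}"
      using eq[OF \<open>k \<in> A\<close>] eq assms(4) by (metis Un_iff equals0I insertI1 subsetI)
    then have "card (A \<union> B) \<le> 1" using card_mono[of "{k}"] by fastforce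
    then show False using card by simp
  qed
qed

lemma exists_annihilators_iff:
  assumes dom: "\<forall>F \<in> set Fs. domain F"
    and x: "x \<in> carrier (RDirProd_list Fs)" and y: "y \<in> carrier (RDirProd_list Fs)"
  defines "R \<equiv> RDirProd_list Fs"
  shows "(\<exists>r \<in> Ann R x. \<exists>s \<in> Ann R y. r \<noteq> \<zero>\<^bsub>R\<^esub> \<and> s \<noteq> \<zero>\<^bsub>R\<^esub> \<and> r \<otimes>\<^bsub>R\<^esub> s = \<zero>\<^bsub>R\<^esub>)
    \<longleftrightarrow> (\<exists>i \<in> {1..length Fs} - supp Fs x. \<exists>j \<in> {1..length Fs} - supp Fs y. i \<noteq> j)"
    (is "?ann \<longleftrightarrow> ?idx")
proof
  assume ?ann
  then obtain r s where r: "r \<in> carrier R" "r \<otimes>\<^bsub>R\<^esub> x = \<zero>\<^bsub>R\<^esub>" "r \<noteq> \<zero>\<^bsub>R\<^esub>"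
    and s: "s \<in> carrier R" "s \<otimes>\<^bsub>R\<^esub> y = \<zero>\<^bsub>R\<^esub>" "s \<noteq> \<zero>\<^bsub>R\<^esub>" and "r \<otimes>\<^bsub>R\<^esub> s = \<zero>\<^bsub>R\<^esub>"
    unfolding Ann_def by blast
  then have "supp Fs r \<inter> supp Fs x = {}" "supp Fs s \<inter> supp Fs y = {}"
    and "supp Fs r \<inter> supp Fs s = {}"
    using x y unfolding R_def by (simp_all only: mult_eq_zero_iff_supp_disjoint[OF dom])
  \<comment> \<open>Nonzero elements have nonempty support. The chosen indices will differ because
    \<open>r\<close> and \<open>s\<close> have disjoint supports.\<close>
  moreover obtain i j where "i \<in> supp Fs r" "j \<in> supp Fs s"
    using r s supp_eq_empty_iff unfolding R_def by (meson all_not_in_conv)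
  moreover from this have "i \<in> {1..length Fs}" "j \<in> {1..length Fs}"
    using supp_subset by blast+
  ultimately have "i \<in> {1..length Fs} - supp Fs x" "j \<in> {1..length Fs} - supp Fs y" "i \<noteq> j"
    by blast+
  then show ?idx by blast
next
  assume ?idx
  then obtain i j where ij: "i \<in> {1..length Fs}" "i \<notin> supp Fs x"
    "j \<in> {1..length Fs}" "j \<notin> supp Fs y" "i \<noteq> j" by blast
  \<comment> \<open>Annihilators supported at a single index suffice: \<open>{i}\<close> misses the
    support of \<open>x\<close>, \<open>{j}\<close> misses that of \<open>y\<close>, and the two are
    disjoint.\<close>
  obtain r where r: "r \<in> carrier R" "supp Fs r = {i}"
    using exists_supp_eq[OF dom, of "{i}"] ij(1) unfolding R_def by blast
  obtain s where s: "s \<in> carrier R" "supp Fs s = {j}"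
    using exists_supp_eq[OF dom, of "{j}"] ij(3) unfolding R_def by blast
  have "r \<in> Ann R x" "s \<in> Ann R y" "r \<otimes>\<^bsub>R\<^esub> s = \<zero>\<^bsub>R\<^esub>"
    using r s x y ij unfolding R_def
    by (simp_all add: Ann_def mult_eq_zero_iff_supp_disjoint[OF dom])
  moreover have "r \<noteq> \<zero>\<^bsub>R\<^esub>" "s \<noteq> \<zero>\<^bsub>R\<^esub>"
    using r s unfolding R_def by (simp_all only: supp_eq_empty_iff[symmetric]) simp_all
  ultimately show ?ann by blast
qed

text \<open>The unordered edge \<open>{x, y}\<close> may come from \<open>P x y\<close> or from
  \<open>P y x\<close>, hence the symmetry assumption at this pair.\<close>

lemma adjacent_graph_on:
  assumes "x \<in> V" "y \<in> V" "x \<noteq> y" "P y x \<longleftrightarrow> P x y"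
  shows "adjacent (graph_on V P) x y \<longleftrightarrow> P x y"
  using assms by (auto simp: adjacent_def graph_on_def doubleton_eq_iff)

text \<open>Deleting isolated vertices leaves the edge set unchanged, and adjacency looks only at
  edges.\<close>

lemma adjacent_difference_graph:
  "adjacent (weak_zero_divisor_difference_graph R) x y \<longleftrightarrow>
    adjacent (weakly_zero_divisor_graph R) x y \<and> \<not> adjacent (zero_divisor_graph R) x y"
  by (simp add: adjacent_def weak_zero_divisor_difference_graph_def delete_isolated_def)

theorem theorem3p1:
  fixes Fs :: "('a, 'm) ring_scheme list"
    and A B :: "nat set"
    and x y :: "'a list"
  assumes finite_fields: "\<forall>F \<in> set Fs. field F \<and> finite (carrier F)"
    and A: "A \<noteq> {}" "A \<subset> {1..length Fs}"
    and B: "B \<noteq> {}" "B \<subset> {1..length Fs}"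
    and x: "x \<in> support_class Fs A"
    and y: "y \<in> support_class Fs B"
    and distinct: "x \<noteq> y"
  shows "(adjacent (zero_divisor_graph (RDirProd_list Fs)) x y \<longleftrightarrow> A \<inter> B = {})
    \<and> (adjacent (weakly_zero_divisor_graph (RDirProd_list Fs)) x y \<longleftrightarrow>
         card (({1..length Fs} - A) \<union> ({1..length Fs} - B)) \<ge> 2)
    \<and> (adjacent (weak_zero_divisor_difference_graph (RDirProd_list Fs)) x y \<longleftrightarrow>
         A \<inter> B \<noteq> {} \<and> card (({1..length Fs} - A) \<union> ({1..length Fs} - B)) \<ge> 2)"
proof -
  let ?R = "RDirProd_list Fs"
  have dom: "\<forall>F \<in> set Fs. domain F"
    using finite_fields by (auto simp: field_def)
  have vx: "x \<in> nonzero_zero_divisors ?R" and sx: "supp Fs x = A"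
    and vy: "y \<in> nonzero_zero_divisors ?R" and sy: "supp Fs y = B"
    using x y by (simp_all add: support_class_def)
  have cx: "x \<in> carrier ?R" and cy: "y \<in> carrier ?R"
    using vx vy by (simp_all add: nonzero_zero_divisors_def zero_divisors_def)
  note mult_zero = mult_eq_zero_iff_supp_disjoint[OF dom]
  note annihilators = exists_annihilators_iff[OF dom]
  have zero: "adjacent (zero_divisor_graph ?R) x y \<longleftrightarrow> A \<inter> B = {}"
    unfolding zero_divisor_graph_def
    using vx vy distinct sx sy cx cy
    by (subst adjacent_graph_on) (auto simp: mult_zero)
  \<comment> \<open>This supplies the symmetry required by \<open>adjacent_graph_on\<close>, once
    both orders of the annihilator condition are expressed through indices.\<close>
  have swap: "(\<exists>i \<in> S. \<exists>j \<in> T. i \<noteq> j) \<longleftrightarrow> (\<exists>i \<in> T. \<exists>j \<in> S. i \<noteq> j)"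
    for S T :: "nat set" by metis
  have "adjacent (weakly_zero_divisor_graph ?R) x y
      \<longleftrightarrow> (\<exists>i \<in> {1..length Fs} - A. \<exists>j \<in> {1..length Fs} - B. i \<noteq> j)"
    unfolding weakly_zero_divisor_graph_def
    by (subst adjacent_graph_on[OF vx vy distinct],
        unfold annihilators[OF cx cy] annihilators[OF cy cx] sx sy)
      (rule swap refl)+
  \<comment> \<open>Both complements are nonempty because \<open>A\<close> and \<open>B\<close> are
    proper subsets.\<close>
  also have "\<dots> \<longleftrightarrow> 2 \<le> card (({1..length Fs} - A) \<union> ({1..length Fs} - B))"
    using A B by (intro exists_distinct_mem_iff_two_le_card_Un) auto
  finally have "adjacent (weakly_zero_divisor_graph ?R) x y
      \<longleftrightarrow> 2 \<le> card (({1..length Fs} - A) \<union> ({1..length Fs} - B))" .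
  with zero show ?thesis
    by (auto simp: adjacent_difference_graph)
qed

end
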